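(* Let $\mathcal G$ be a locally compact Hausdorff $\sigma$-compact étale ample groupoid with compact unit space. If $\mathcal G$ is minimal and almost finite in Matui's sense, then $\mathcal G$ is almost elementary.
   Context: Ample: basis of compact open bisections. $Au=\{x\in A:s(x)=u\}$, $AB=\{xy:x\in A,y\in B,s(x)=r(y)\}$. Matui's almost finiteness: for every compact $K\subseteq\mathcal G$ and $\varepsilon>0$ there is a compact open principal subgroupoid $\mathcal H$ with $\mathcal H^{(0)}=\mathcal G^{(0)}$ and $|K\mathcal Hu\setminus\mathcal Hu|<\varepsilon|\mathcal Hu|$ for all $u\in\mathcal G^{(0)}$. Multisection: finite family $\{C_{i,j}:i,j\in F\}$ of bisections with $C_{i,j}C_{j,k}=C_{i,k}$ and pairwise disjoint levels $C_{i,i}\subseteq\mathcal G^{(0)}$. Castle: finite family $\{C^l_{i,j}:i,j\in F_l,l\in I\}$ of multisections with $C^l_{i,j}C^{l'}_{i',j'}=\emptyset$ for $l\ne l'$; open if all members open. $\mathcal C$ is $K$-extendable to $\mathcal D=\{D^l_{i,j}:i,j\in E_l,l\in I\}$ if $F_l\subseteq E_l$, $C^l_{i,j}=D^l_{i,j}$ for $i,j\in F_l$, and $K\cdot\bigcup\mathcal C\subseteq\bigcup\mathcal D$. $K\prec_{\mathcal G}V$: there are open bisections $A_1,\dots,A_n$ with $K\subseteq\bigcup s(A_i)$ and $r(A_i)$ pairwise disjoint subsets of $V$. Almost elementary: for every compact $K\supseteq\mathcal G^{(0)}$, nonempty open $O\subseteq\mathcal G^{(0)}$ and open cover $\mathcal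 V$ of $\mathcal G^{(0)}$ there are open castles $\mathcal C,\mathcal D$, $\mathcal C$ $K$-extendable to $\mathcal D$, each level of $\mathcal D$ contained in a member of $\mathcal V$, and $\mathcal G^{(0)}\setminus\bigcup(\text{levels of }\mathcal C)\prec_{\mathcal G}O$. *)

theory Defs
  imports "HOL-Analysis.Analysis"
begin

text \<open>A topological groupoid: carrier, topology, source, range, (partial) multiplication
  (x*y defined when s x = r y), inverse.\<close>
record 'g groupoid =
  gcarr :: "'g set"
  gtop  :: "'g topology"
  gs    :: "'g \<Rightarrow> 'g"
  gr    :: "'g \<Rightarrow> 'g"
  gm    :: "'g \<Rightarrow> 'g \<Rightarrow> 'g"
  gi    :: "'g \<Rightarrow> 'g"

definition is_groupoid :: "'g groupoid \<Rightarrow> bool" where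
  "is_groupoid G \<longleftrightarrow>
     (\<forall>x\<in>gcarr G. gs G x \<in> gcarr G \<and> gr G x \<in> gcarr G \<and> gi G x \<in> gcarr G) \<and>
     (\<forall>x\<in>gcarr G. gs G (gs G x) = gs G x \<and> gr G (gs G x) = gs G x \<and>
                   gs G (gr G x) = gr G x \<and> gr G (gr G x) = gr G x) \<and>
     (\<forall>x\<in>gcarr G. \<forall>y\<in>gcarr G. gs G x = gr G y \<longrightarrow>
        gm G x y \<in> gcarr G \<and> gs G (gm G x y) = gs G y \<and> gr G (gm G x y) = gr G x) \<and>
     (\<forall>x\<in>gcarr G. \<forall>y\<in>gcarr G. \<forall>z\<in>gcarr G. gs G x = gr G y \<and> gs G y = gr G z \<longrightarrow>
        gm G (gm G x y) z = gm G x (gm G y z)) \<and>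
     (\<forall>x\<in>gcarr G. gm G (gr G x) x = x \<and> gm G x (gs G x) = x) \<and>
     (\<forall>x\<in>gcarr G. gs G (gi G x) = gr G x \<and> gr G (gi G x) = gs G x \<and>
        gm G x (gi G x) = gr G x \<and> gm G (gi G x) x = gs G x)"

definition gunits :: "'g groupoid \<Rightarrow> 'g set" where
  "gunits G = gs G ` gcarr G"

definition composable_pairs :: "'g groupoid \<Rightarrow> ('g \<times> 'g) set" where
  "composable_pairs G = {(x, y). x \<in> gcarr G \<and> y \<in> gcarr G \<and> gs G x = gr G y}"

definition topological_groupoid :: "'g groupoid \<Rightarrow> bool" where
  "topological_groupoid G \<longleftrightarrow> is_groupoid G \<and> topspace (gtop G) = gcarr G \<and>
     continuous_map (subtopology (prod_topology (gtop G) (gtop G)) (composable_pairs G))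
                    (gtop G) (\<lambda>(x, y). gm G x y) \<and>
     continuous_map (gtop G) (gtop G) (gi G)"

definition etale :: "'g groupoid \<Rightarrow> bool" where
  "etale G \<longleftrightarrow> topological_groupoid G \<and>
     (\<forall>x\<in>gcarr G. \<exists>U. openin (gtop G) U \<and> x \<in> U \<and> openin (gtop G) (gr G ` U) \<and>
        homeomorphic_map (subtopology (gtop G) U) (subtopology (gtop G) (gr G ` U)) (gr G))"

definition bisection :: "'g groupoid \<Rightarrow> 'g set \<Rightarrow> bool" where
  "bisection G B \<longleftrightarrow> B \<subseteq> gcarr G \<and> inj_on (gs G) B \<and> inj_on (gr G) B"

definition open_bisection :: "'g groupoid \<Rightarrow> 'g set \<Rightarrow> bool" where
  "open_bisection G B \<longleftrightarrow> openin (gtop G) B \<and> bisection G B"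

definition ample :: "'g groupoid \<Rightarrow> bool" where
  "ample G \<longleftrightarrow> (\<forall>U x. openin (gtop G) U \<and> x \<in> U \<longrightarrow>
      (\<exists>B. compactin (gtop G) B \<and> open_bisection G B \<and> x \<in> B \<and> B \<subseteq> U))"

definition sigma_compact_space :: "'a topology \<Rightarrow> bool" where
  "sigma_compact_space T \<longleftrightarrow>
     (\<exists>\<K>. countable \<K> \<and> (\<forall>K\<in>\<K>. compactin T K) \<and> \<Union>\<K> = topspace T)"

definition orbit :: "'g groupoid \<Rightarrow> 'g \<Rightarrow> 'g set" where
  "orbit G u = gr G ` {x \<in> gcarr G. gs G x = u}"

definition minimal :: "'g groupoid \<Rightarrow> bool" where
  "minimal G \<longleftrightarrow> (\<forall>u\<in>gunits G.
     subtopology (gtop G) (gunits G) closure_of (orbit G u) = gunits G)"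

definition setprod :: "'g groupoid \<Rightarrow> 'g set \<Rightarrow> 'g set \<Rightarrow> 'g set" where
  "setprod G A B = {gm G x y | x y. x \<in> A \<and> y \<in> B \<and> gs G x = gr G y}"

definition sfibre :: "'g groupoid \<Rightarrow> 'g set \<Rightarrow> 'g \<Rightarrow> 'g set" where
  "sfibre G A u = {x \<in> A. gs G x = u}"

definition subgroupoid :: "'g groupoid \<Rightarrow> 'g set \<Rightarrow> bool" where
  "subgroupoid G H \<longleftrightarrow> H \<subseteq> gcarr G \<and>
     (\<forall>x\<in>H. \<forall>y\<in>H. gs G x = gr G y \<longrightarrow> gm G x y \<in> H) \<and> (\<forall>x\<in>H. gi G x \<in> H)"

definition principal_on :: "'g groupoid \<Rightarrow> 'g set \<Rightarrow> bool" where
  "principal_on G H \<longleftrightarrow> inj_on (\<lambda>x. (gr G x, gs G x)) H"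

definition almost_finite :: "'g groupoid \<Rightarrow> bool" where
  "almost_finite G \<longleftrightarrow> (\<forall>K (\<epsilon>::real). compactin (gtop G) K \<and> \<epsilon> > 0 \<longrightarrow>
     (\<exists>H. subgroupoid G H \<and> gs G ` H = gunits G \<and>
          compactin (gtop G) H \<and> openin (gtop G) H \<and> principal_on G H \<and>
          (\<forall>u\<in>gunits G.
             real (card (setprod G K (sfibre G H u) - sfibre G H u))
               < \<epsilon> * real (card (sfibre G H u)))))"

definition multisection :: "'g groupoid \<Rightarrow> nat set \<Rightarrow> (nat \<Rightarrow> nat \<Rightarrow> 'g set) \<Rightarrow> bool" where
  "multisection G F C \<longleftrightarrow> finite F \<and>
     (\<forall>i\<in>F. \<forall>j\<in>F. bisection G (C i j)) \<and>
     (\<forall>i\<in>F. \<forall>j\<in>F. \<forall>k\<in>F. setprod G (C i j) (C j k) = C i k) \<and>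
     (\<forall>i\<in>F. C i i \<subseteq> gunits G) \<and>
     (\<forall>i\<in>F. \<forall>j\<in>F. i \<noteq> j \<longrightarrow> C i i \<inter> C j j = {})"

definition castle :: "'g groupoid \<Rightarrow> nat set \<Rightarrow> (nat \<Rightarrow> nat set) \<Rightarrow> (nat \<Rightarrow> nat \<Rightarrow> nat \<Rightarrow> 'g set) \<Rightarrow> bool" where
  "castle G I F C \<longleftrightarrow> finite I \<and> (\<forall>l\<in>I. multisection G (F l) (C l)) \<and>
     (\<forall>l\<in>I. \<forall>l'\<in>I. l \<noteq> l' \<longrightarrow>
        (\<forall>i\<in>F l. \<forall>j\<in>F l. \<forall>i'\<in>F l'. \<forall>j'\<in>F l'. setprod G (C l i j) (C l' i' j') = {}))"

definition open_castle :: "'g groupoid \<Rightarrow> nat set \<Rightarrow> (nat \<Rightarrow> nat set) \<Rightarrow> (nat \<Rightarrow> nat \<Rightarrow> nat \<Rightarrow> 'g set) \<Rightarrow> bool" where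
  "open_castle G I F C \<longleftrightarrow> castle G I F C \<and>
     (\<forall>l\<in>I. \<forall>i\<in>F l. \<forall>j\<in>F l. openin (gtop G) (C l i j))"

definition castle_union :: "nat set \<Rightarrow> (nat \<Rightarrow> nat set) \<Rightarrow> (nat \<Rightarrow> nat \<Rightarrow> nat \<Rightarrow> 'g set) \<Rightarrow> 'g set" where
  "castle_union I F C = (\<Union>l\<in>I. \<Union>i\<in>F l. \<Union>j\<in>F l. C l i j)"

definition castle_levels :: "nat set \<Rightarrow> (nat \<Rightarrow> nat set) \<Rightarrow> (nat \<Rightarrow> nat \<Rightarrow> nat \<Rightarrow> 'g set) \<Rightarrow> 'g set set" where
  "castle_levels I F C = {C l i i | l i. l \<in> I \<and> i \<in> F l}"

definition extendable ::
  "'g groupoid \<Rightarrow> 'g set \<Rightarrow> nat set \<Rightarrow> (nat \<Rightarrow> nat set) \<Rightarrow> (nat \<Rightarrow> nat \<Rightarrow> nat \<Rightarrow> 'g set)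
     \<Rightarrow> (nat \<Rightarrow> nat set) \<Rightarrow> (nat \<Rightarrow> nat \<Rightarrow> nat \<Rightarrow> 'g set) \<Rightarrow> bool" where
  "extendable G K I F C E D \<longleftrightarrow>
     (\<forall>l\<in>I. F l \<subseteq> E l \<and> (\<forall>i\<in>F l. \<forall>j\<in>F l. C l i j = D l i j)) \<and>
     setprod G K (castle_union I F C) \<subseteq> castle_union I E D"

definition subequiv :: "'g groupoid \<Rightarrow> 'g set \<Rightarrow> 'g set \<Rightarrow> bool" where
  "subequiv G A V \<longleftrightarrow> (\<exists>(n::nat) B. (\<forall>k<n. open_bisection G (B k)) \<and>
     A \<subseteq> (\<Union>k<n. gs G ` B k) \<and> (\<forall>k<n. gr G ` B k \<subseteq> V) \<and>
     (\<forall>k<n. \<forall>k'<n. k \<noteq> k' \<longrightarrow> gr G ` B k \<inter> gr G ` B k' = {}))"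

definition almost_elementary :: "'g groupoid \<Rightarrow> bool" where
  "almost_elementary G \<longleftrightarrow>
     (\<forall>K Ob \<V>. compactin (gtop G) K \<and> gunits G \<subseteq> K \<and>
        openin (subtopology (gtop G) (gunits G)) Ob \<and> Ob \<noteq> {} \<and>
        (\<forall>V\<in>\<V>. openin (subtopology (gtop G) (gunits G)) V) \<and> gunits G \<subseteq> \<Union>\<V> \<longrightarrow>
        (\<exists>I F C E D. open_castle G I F C \<and> open_castle G I E D \<and>
           extendable G K I F C E D \<and>
           (\<forall>L\<in>castle_levels I E D. \<exists>V\<in>\<V>. L \<subseteq> V) \<and>
           subequiv G (gunits G - \<Union>(castle_levels I F C)) Ob))"

end

theory Submission
  imports Defs
begin

text \<open>
  Enlarge the compact set to a finite union of \<open>N\<close> compact open bisections, and use minimality to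
  find \<open>m\<close> open bisections whose sources cover the unit space and whose ranges lie in the prescribed
  open set \<open>O\<close>. For an elementary subgroupoid \<open>H\<close> that is \<open>1/(m(N+1))\<close>-invariant under all of these,
  double counting shows that in every \<open>H\<close>-orbit the points that the compact set moves out of \<open>H\<close>
  (a clopen set \<open>R\<close>) are at most as many as the points in \<open>O\<close>. Cut the unit space into finitely many
  clopen pieces, each meeting every \<open>H\<close>-orbit at most once, and group the units by the set of pieces
  which their orbit visits: this presents \<open>H\<close> as a castle. The castle formed by the levels outside
  \<open>R\<close> extends to it, and inside each tower the levels in \<open>R\<close> inject into those in \<open>O\<close>.
\<close>

section \<open>Topological preliminaries\<close>

text \<open>Carrying an arbitrary property \<open>Q\<close> along with the cover lets the later
  compactness arguments be reduced to a statement about one point.\<close>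

lemma compactin_finite_cover:
  assumes "compactin X S" "\<And>v. v \<in> S \<Longrightarrow> \<exists>N. openin X N \<and> v \<in> N \<and> Q N"
  obtains \<F> where "finite \<F>" "\<And>N. N \<in> \<F> \<Longrightarrow> openin X N \<and> Q N" "S \<subseteq> \<Union>\<F>"
proof -
  have "S \<subseteq> \<Union>{N. openin X N \<and> Q N}"
    using assms(2) by blast
  then obtain \<F> where "finite \<F>" "\<F> \<subseteq> {N. openin X N \<and> Q N}" "S \<subseteq> \<Union>\<F>"
    using assms(1) unfolding compactin_def by (metis (no_types, lifting) mem_Collect_eq)
  then show thesis
    using that by blast
qed

lemma compactin_Diff_openin:
  assumes "compactin X S" "openin X U"
  shows "compactin X (S - U)"
proof -
  have "S - U = S \<inter> (topspace X - U)"
    using compactin_subset_topspace[OF assms(1)] by blast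
  then show ?thesis
    using assms by (simp add: compact_Int_closedin closedin_diff)
qed

lemma openin_Diff_compactin:
  assumes "Hausdorff_space X" "openin X U" "compactin X S"
  shows "openin X (U - S)"
  using assms by (simp add: compactin_imp_closedin openin_diff)

text \<open>A finite cover becomes disjoint once each set loses the earlier ones. In a Hausdorff
  space the differences of compact open sets are again compact and open, and \<open>her\<close> lets
  \<open>Q\<close> survive the shrinking.\<close>

lemma finite_compact_open_partition:
  assumes haus: "Hausdorff_space X" and cpt: "compactin X S"
    and loc: "\<And>v. v \<in> S \<Longrightarrow> \<exists>N. openin X N \<and> v \<in> N \<and> compactin X N \<and> Q N"
    and her: "\<And>M N. Q N \<Longrightarrow> M \<subseteq> N \<Longrightarrow> Q M"
  obtains n :: nat and P where
    "\<And>a. a < n \<Longrightarrow> openin X (P a) \<and> compactin X (P a) \<and> Q (P a)"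
    "S \<subseteq> (\<Union>a<n. P a)" "disjoint_family P"
proof -
  obtain \<F> where \<F>: "finite \<F>" "\<And>N. N \<in> \<F> \<Longrightarrow> openin X N \<and> (compactin X N \<and> Q N)" "S \<subseteq> \<Union>\<F>"
    using compactin_finite_cover[OF cpt, of "\<lambda>N. compactin X N \<and> Q N"] loc by metis
  obtain f where f: "bij_betw f {0..<card \<F>} \<F>"
    using ex_bij_betw_nat_finite[OF \<F>(1)] by blast
  have f\<F>: "f b \<in> \<F>" if "b < card \<F>" for b
    using f that by (auto simp: bij_betw_def)
  have "openin X (disjointed f a) \<and> compactin X (disjointed f a) \<and> Q (disjointed f a)"
    if a: "a < card \<F>" for a
  proof -
    have U: "openin X (\<Union>b\<in>{0..<a}. f b)" "compactin X (\<Union>b\<in>{0..<a}. f b)"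
      using a f\<F> \<F>(2) by (auto intro!: openin_Union compactin_Union)
    show ?thesis
      using her[of "f a" "disjointed f a"] \<F>(2)[OF f\<F>[OF a]] U haus
      by (auto simp: disjointed_def intro!: compactin_Diff_openin openin_Diff_compactin)
  qed
  moreover have "S \<subseteq> (\<Union>a<card \<F>. disjointed f a)"
    using \<F>(3) f finite_UN_disjointed_eq[of f "card \<F>"]
    by (auto simp: bij_betw_def atLeast0LessThan)
  ultimately show thesis
    using that[of "card \<F>" "disjointed f"] disjoint_family_disjointed[of f] by blast
qed

section \<open>Groupoids\<close>

locale alg_groupoid =
  fixes G :: "'g groupoid"
  assumes groupoid: "is_groupoid G"
begin

abbreviation "\<s> \<equiv> gs G"
abbreviation "\<r> \<equiv> gr G"
abbreviation "\<m> \<equiv> gm G"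
abbreviation "\<iota> \<equiv> gi G"
abbreviation "Car \<equiv> gcarr G"
abbreviation "Units \<equiv> gunits G"

lemma carr [simp]:
  assumes "x \<in> Car" shows "\<s> x \<in> Car" "\<r> x \<in> Car" "\<iota> x \<in> Car"
    "\<s> (\<s> x) = \<s> x" "\<r> (\<s> x) = \<s> x" "\<s> (\<r> x) = \<r> x" "\<r> (\<r> x) = \<r> x"
    "\<m> (\<r> x) x = x" "\<m> x (\<s> x) = x" "\<s> (\<iota> x) = \<r> x" "\<r> (\<iota> x) = \<s> x"
    "\<m> x (\<iota> x) = \<r> x" "\<m> (\<iota> x) x = \<s> x"
  using groupoid assms unfolding is_groupoid_def by blast+

lemma mult [simp]:
  assumes "x \<in> Car" "y \<in> Car" "\<s> x = \<r> y"
  shows "\<m> x y \<in> Car" "\<s> (\<m> x y) = \<s> y" "\<r> (\<m> x y) = \<r> x"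
  using groupoid assms unfolding is_groupoid_def by blast+

lemma mult_assoc:
  assumes "x \<in> Car" "y \<in> Car" "z \<in> Car" "\<s> x = \<r> y" "\<s> y = \<r> z"
  shows "\<m> (\<m> x y) z = \<m> x (\<m> y z)"
  using groupoid assms unfolding is_groupoid_def by blast

lemma mult_inv_cancel:
  assumes "k \<in> Car" "x \<in> Car" "\<s> k = \<r> x"
  shows "\<m> (\<m> k x) (\<iota> x) = k" "\<m> (\<iota> k) (\<m> k x) = x"
  using assms mult_assoc[of k x "\<iota> x"] mult_assoc[of "\<iota> k" k x] carr(8)[of x] carr(9)[of k]
  by auto

lemma inv_inv [simp]:
  assumes "x \<in> Car" shows "\<iota> (\<iota> x) = x"
  using mult_inv_cancel(2)[of "\<iota> x" x] carr(9)[of "\<iota> (\<iota> x)"] assms by simp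

lemma unitsI [simp]: "x \<in> Car \<Longrightarrow> \<s> x \<in> Units" "x \<in> Car \<Longrightarrow> \<r> x \<in> Units"
  unfolding gunits_def using carr(6)[of x] carr(2)[of x] by (auto intro: image_eqI[of _ _ "\<r> x"])

lemma unitsD [simp]:
  assumes "u \<in> Units" shows "u \<in> Car" "\<s> u = u" "\<r> u = u"
  using assms unfolding gunits_def by auto

text \<open>An arrow \<open>x\<close> is recovered from the product \<open>k x\<close> and the bisection containing \<open>k\<close>.\<close>

lemma card_le_bisection_translates:
  assumes fin: "finite \<B>" "finite Y" and X: "X \<subseteq> Car"
    and bis: "\<And>B. B \<in> \<B> \<Longrightarrow> bisection G B"
    and move: "\<And>x. x \<in> X \<Longrightarrow> \<exists>B\<in>\<B>. \<exists>k\<in>B. \<s> k = \<r> x \<and> \<m> k x \<in> Y"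
  shows "card X \<le> card \<B> * card Y"
proof -
  obtain B k where Bk: "\<And>x. x \<in> X \<Longrightarrow> B x \<in> \<B> \<and> k x \<in> B x \<and> \<s> (k x) = \<r> x \<and> \<m> (k x) x \<in> Y"
    using move by metis
  have kC: "k x \<in> Car" if "x \<in> X" for x
    using Bk[OF that] bis unfolding bisection_def by blast
  have "inj_on (\<lambda>x. (B x, \<m> (k x) x)) X"
  proof (rule inj_onI)
    fix x y assume xy: "x \<in> X" "y \<in> X" and eq: "(B x, \<m> (k x) x) = (B y, \<m> (k y) y)"
    have "\<r> (k x) = \<r> (k y)"
      using eq xy Bk[OF xy(1)] Bk[OF xy(2)] kC X mult(3) by (metis Pair_inject in_mono)
    then have "k x = k y"
      using eq Bk[OF xy(1)] Bk[OF xy(2)] bis[of "B x"] by (auto simp: bisection_def inj_on_def)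
    then show "x = y"
      using eq xy Bk[OF xy(1)] Bk[OF xy(2)] kC X mult_inv_cancel(2) by (metis Pair_inject in_mono)
  qed
  then have "card X \<le> card (\<B> \<times> Y)"
    using Bk fin by (intro card_inj_on_le[where f = "\<lambda>x. (B x, \<m> (k x) x)"]) auto
  then show ?thesis
    by (simp add: card_cartesian_product)
qed

text \<open>Each bisection meets a source fibre in at most one arrow.\<close>

lemma finite_bisections_sfibre:
  assumes "finite \<B>" "\<And>B. B \<in> \<B> \<Longrightarrow> bisection G B" "A \<subseteq> \<Union>\<B>"
  shows "finite (sfibre G A u)"
proof -
  have "finite (sfibre G B u)" if "B \<in> \<B>" for B
  proof (rule inj_on_finite)
    show "inj_on \<s> (sfibre G B u)"
      using assms(2)[OF that] by (auto simp: bisection_def sfibre_def inj_on_def)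
    show "\<s> ` sfibre G B u \<subseteq> {u}"
      by (auto simp: sfibre_def)
  qed simp
  moreover have "sfibre G A u \<subseteq> (\<Union>B\<in>\<B>. sfibre G B u)"
    using assms(3) by (auto simp: sfibre_def)
  ultimately show ?thesis
    using assms(1) finite_subset by blast
qed

lemma finite_setprod_bisections:
  assumes "finite \<B>" "\<And>B. B \<in> \<B> \<Longrightarrow> bisection G B" "finite Y"
  shows "finite (setprod G (\<Union>\<B>) Y)"
proof -
  have "finite (sfibre G (\<Union>\<B>) v)" for v
    using finite_bisections_sfibre[OF assms(1,2)] by blast
  moreover have "setprod G (\<Union>\<B>) Y \<subseteq> (\<Union>y\<in>Y. (\<lambda>k. \<m> k y) ` sfibre G (\<Union>\<B>) (\<r> y))"
    by (auto simp: setprod_def sfibre_def)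
  ultimately show ?thesis
    using assms(3) finite_subset by blast
qed

end

text \<open>The bisections in \<open>subequiv\<close> are numbered by an initial segment of the
  naturals. Allowing any finite index set makes it possible to index them later by pairs of a tower
  and a level.\<close>

lemma subequiv_finite_family:
  assumes "finite J" "\<And>j. j \<in> J \<Longrightarrow> open_bisection G (B j)"
    "A \<subseteq> (\<Union>j\<in>J. gs G ` B j)" "\<And>j. j \<in> J \<Longrightarrow> gr G ` B j \<subseteq> V"
    "\<And>j j'. j \<in> J \<Longrightarrow> j' \<in> J \<Longrightarrow> j \<noteq> j' \<Longrightarrow> gr G ` B j \<inter> gr G ` B j' = {}"
  shows "subequiv G A V"
proof -
  obtain f where "bij_betw f {0..<card J} J"
    using ex_bij_betw_nat_finite[OF assms(1)] by blast
  then have f: "f ` {..<card J} = J" "inj_on f {..<card J}"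
    by (auto simp: bij_betw_def atLeast0LessThan)
  have fJ: "f k \<in> J" if "k < card J" for k
    using f(1) that by blast
  show ?thesis
    unfolding subequiv_def
  proof (intro exI[of _ "card J"] exI[of _ "\<lambda>k. B (f k)"] conjI allI impI)
    show "A \<subseteq> (\<Union>k<card J. gs G ` B (f k))"
    proof
      fix x assume "x \<in> A"
      then obtain j where "j \<in> J" "x \<in> gs G ` B j"
        using assms(3) by blast
      moreover obtain k where "k < card J" "j = f k"
        using f(1) \<open>j \<in> J\<close> by blast
      ultimately show "x \<in> (\<Union>k<card J. gs G ` B (f k))"
        by blast
    qed
  next
    fix k k' assume k: "k < card J" "k' < card J" "k \<noteq> k'"
    then have "f k \<noteq> f k'"
      using f(2) by (auto simp: inj_on_def)
    then show "gr G ` B (f k) \<inter> gr G ` B (f k') = {}"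
      using assms(5) fJ k by blast
  qed (use assms(2,4) fJ in blast)+
qed

section \<open>Ample groupoids\<close>

locale ample_groupoid = alg_groupoid +
  assumes etale: "etale G" and haus: "Hausdorff_space (gtop G)" and ample: "ample G"
    and compact_units: "compactin (gtop G) Units"
begin

abbreviation "T \<equiv> gtop G"

lemma topspace_T [simp]: "topspace T = Car"
  using etale by (simp add: etale_def topological_groupoid_def)

section \<open>Continuity and openness of range and source\<close>

lemma continuous_inv: "continuous_map T T \<iota>"
  using etale by (simp add: etale_def topological_groupoid_def)

text \<open>The range of \<open>x\<close> is the product of \<open>x\<close> and its inverse, so
  continuity comes from that of multiplication and inversion.\<close>

lemma continuous_r: "continuous_map T T \<r>"
proof -
  have "continuous_map T (subtopology (prod_topology T T) (composable_pairs G)) (\<lambda>x. (x, \<iota> x))"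
    using continuous_inv
    by (auto simp: continuous_map_in_subtopology continuous_map_pairwise o_def composable_pairs_def)
  moreover have "continuous_map (subtopology (prod_topology T T) (composable_pairs G)) T (\<lambda>(x, y). \<m> x y)"
    using etale by (simp add: etale_def topological_groupoid_def)
  ultimately have "continuous_map T T ((\<lambda>(x, y). \<m> x y) \<circ> (\<lambda>x. (x, \<iota> x)))"
    by (rule continuous_map_compose)
  then show ?thesis
    by (rule continuous_map_eq) simp
qed

lemma continuous_s: "continuous_map T T \<s>"
  by (rule continuous_map_eq[OF continuous_map_compose[OF continuous_inv continuous_r]]) simp

text \<open>Openness is checked near each point of the image, where the range map restricts to a
  homeomorphism between open sets.\<close>

lemma openin_r_image:
  assumes "openin T U" shows "openin T (\<r> ` U)"
proof (subst openin_subopen, safe)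
  fix x assume x: "x \<in> U"
  then have "x \<in> Car"
    using openin_subset[OF assms] by auto
  then obtain W where W: "openin T W" "x \<in> W" "openin T (\<r> ` W)"
      "homeomorphic_map (subtopology T W) (subtopology T (\<r> ` W)) \<r>"
    using etale by (auto simp: etale_def)
  have "openin (subtopology T W) (U \<inter> W)"
    using assms by (auto simp: openin_subtopology)
  then have "openin (subtopology T (\<r> ` W)) (\<r> ` (U \<inter> W))"
    using W(4) homeomorphic_imp_open_map open_map_def by blast
  then have "openin T (\<r> ` (U \<inter> W))"
    using W(3) openin_trans_full by blast
  then show "\<exists>V. openin T V \<and> \<r> x \<in> V \<and> V \<subseteq> \<r> ` U"
    using x W(2) by blast
qed

text \<open>Inversion exchanges source and range. Being an involution, it sends \<open>U\<close> to
  the preimage of \<open>U\<close>, which is open by continuity.\<close>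

lemma openin_s_image:
  assumes "openin T U" shows "openin T (\<s> ` U)"
proof -
  have UC: "U \<subseteq> Car"
    using openin_subset[OF assms] by simp
  have "\<iota> ` U = {x \<in> topspace T. \<iota> x \<in> U}"
    using UC by (force intro: image_eqI[of _ _ "\<iota> _"])
  then have "openin T (\<r> ` \<iota> ` U)"
    using openin_continuous_map_preimage[OF continuous_inv assms] openin_r_image by simp
  moreover have "\<r> ` \<iota> ` U = \<s> ` U"
    using UC by (force simp: image_image)
  ultimately show ?thesis by simp
qed

lemma openin_units: "openin T Units"
proof -
  have "\<r> ` Car = Units"
  proof
    show "Units \<subseteq> \<r> ` Car"
      by (metis imageI subsetI unitsD(1,3))
  qed auto
  then show ?thesis
    using openin_r_image[of Car] openin_topspace[of T] by simp
qed

lemma compactin_s_image: "compactin T S \<Longrightarrow> compactin T (\<s> ` S)"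
  using image_compactin continuous_s by blast

lemma openin_r_preimage: "openin T U \<Longrightarrow> openin T {x \<in> Car. \<r> x \<in> U}"
  using openin_continuous_map_preimage[OF continuous_r] by simp

lemma openin_s_preimage: "openin T U \<Longrightarrow> openin T {x \<in> Car. \<s> x \<in> U}"
  using openin_continuous_map_preimage[OF continuous_s] by simp

section \<open>Compact open bisections and the use of minimality\<close>

lemma compact_open_nhd:
  assumes "openin T U" "x \<in> U"
  obtains B where "compactin T B" "openin T B" "bisection G B" "x \<in> B" "B \<subseteq> U"
  using ample assms unfolding ample_def open_bisection_def by metis

lemma compact_open_bisections_cover:
  assumes "compactin T K"
  obtains \<B> where "finite \<B>" "\<And>B. B \<in> \<B> \<Longrightarrow> openin T B \<and> bisection G B \<and> compactin T B" "K \<subseteq> \<Union>\<B>"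
proof (rule compactin_finite_cover[OF assms, of "\<lambda>B. bisection G B \<and> compactin T B"])
  fix v assume "v \<in> K"
  then have "v \<in> Car"
    using compactin_subset_topspace[OF assms] by auto
  then show "\<exists>N. openin T N \<and> v \<in> N \<and> bisection G N \<and> compactin T N"
    using compact_open_nhd[of Car v] openin_topspace[of T] by (metis topspace_T)
qed (use that in blast)

lemma compact_open_separation:
  assumes "u \<in> Units" "v \<in> Car" "u \<noteq> v"
  obtains N where "compactin T N" "openin T N" "u \<in> N" "v \<notin> N"
proof -
  obtain U where "openin T U" "u \<in> U" "v \<notin> U"
    using haus assms unfolding Hausdorff_space_def topspace_T disjnt_def
    by (metis disjoint_iff unitsD(1))
  then show thesis
    using compact_open_nhd that by (metis in_mono)
qed

text \<open>Since the orbit of \<open>v\<close> is dense, some arrow starts at \<open>v\<close> and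
  ends in \<open>Ob\<close>. A compact open bisection around it, chosen inside the range preimage of
  \<open>Ob\<close>, has an open source containing \<open>v\<close>; compactness of the unit space
  leaves finitely many. Their ranges may overlap.\<close>

lemma minimal_bisections_into:
  assumes min: "minimal G" and Ob: "openin T Ob" "Ob \<subseteq> Units" "Ob \<noteq> {}"
  obtains \<B> where "finite \<B>" "\<And>B. B \<in> \<B> \<Longrightarrow> openin T B \<and> bisection G B \<and> compactin T B \<and> \<r> ` B \<subseteq> Ob"
    "Units \<subseteq> (\<Union>B\<in>\<B>. \<s> ` B)"
proof -
  have "\<exists>N. openin T N \<and> v \<in> N \<and> (\<exists>B. N = \<s> ` B \<and> openin T B \<and> bisection G B \<and> compactin T B \<and> \<r> ` B \<subseteq> Ob)"
    if v: "v \<in> Units" for v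
  proof -
    obtain o' where o': "o' \<in> Ob"
      using Ob by blast
    have "o' \<in> subtopology T Units closure_of (orbit G v)"
      using min v o' Ob(2) unfolding minimal_def by blast
    moreover have "openin (subtopology T Units) Ob"
      using Ob by (auto simp: openin_subtopology)
    ultimately obtain y where "y \<in> orbit G v" "y \<in> Ob"
      using o' unfolding in_closure_of by blast
    then obtain g where g: "g \<in> Car" "\<s> g = v" "\<r> g \<in> Ob"
      unfolding orbit_def by blast
    then obtain B where "compactin T B" "openin T B" "bisection G B" "g \<in> B" "B \<subseteq> {x \<in> Car. \<r> x \<in> Ob}"
      using compact_open_nhd[OF openin_r_preimage[OF Ob(1)], of g] by blast
    then show ?thesis
      using openin_s_image[of B] g by (intro exI[of _ "\<s> ` B"]) blast
  qed
  then obtain \<F> where \<F>: "finite \<F>" "Units \<subseteq> \<Union>\<F>"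
    "\<And>N. N \<in> \<F> \<Longrightarrow> openin T N \<and> (\<exists>B. N = \<s> ` B \<and> openin T B \<and> bisection G B \<and> compactin T B \<and> \<r> ` B \<subseteq> Ob)"
    using compactin_finite_cover[OF compact_units,
      of "\<lambda>N. \<exists>B. N = \<s> ` B \<and> openin T B \<and> bisection G B \<and> compactin T B \<and> \<r> ` B \<subseteq> Ob"] by metis
  then obtain b where b: "\<And>N. N \<in> \<F> \<Longrightarrow> N = \<s> ` b N \<and> openin T (b N) \<and> bisection G (b N) \<and>
      compactin T (b N) \<and> \<r> ` b N \<subseteq> Ob"
    by metis
  show thesis
  proof (rule that[of "b ` \<F>"])
    show "Units \<subseteq> (\<Union>B\<in>b ` \<F>. \<s> ` B)"
      using \<F>(2) b by fastforce
  qed (use \<F>(1) b in auto)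
qed

end

section \<open>Elementary subgroupoids\<close>

locale elementary_subgroupoid = ample_groupoid +
  fixes H
  assumes sub: "subgroupoid G H" and s_H: "\<s> ` H = Units"
    and compact_H: "compactin T H" and open_H: "openin T H" and principal: "principal_on G H"
begin

lemma H_Car [simp]: "x \<in> H \<Longrightarrow> x \<in> Car"
  and H_inv: "x \<in> H \<Longrightarrow> \<iota> x \<in> H"
  and H_mult: "x \<in> H \<Longrightarrow> y \<in> H \<Longrightarrow> \<s> x = \<r> y \<Longrightarrow> \<m> x y \<in> H"
  using sub unfolding subgroupoid_def by blast+

lemma units_H:
  assumes "u \<in> Units" shows "u \<in> H"
proof -
  obtain x where x: "x \<in> H" "u = \<s> x"
    using assms s_H by blast
  then show ?thesis
    using H_mult[OF H_inv[OF x(1)] x(1)] by simp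
qed

lemma H_eqI: "x \<in> H \<Longrightarrow> y \<in> H \<Longrightarrow> \<r> x = \<r> y \<Longrightarrow> \<s> x = \<s> y \<Longrightarrow> x = y"
  using principal unfolding principal_on_def inj_on_def by blast

lemma finite_fibre: "finite (sfibre G H u)"
  using compact_open_bisections_cover[OF compact_H] finite_bisections_sfibre by metis

text \<open>Two units lie in the same \<open>H\<close>-orbit when an arrow of \<open>H\<close> joins
  them, so \<open>N\<close> contains at most one unit of each orbit.\<close>

definition transversal :: "'a set \<Rightarrow> bool" where
  "transversal N \<longleftrightarrow> (\<forall>h\<in>H. \<r> h \<in> N \<longrightarrow> \<s> h \<in> N \<longrightarrow> \<r> h = \<s> h)"

text \<open>The non-unit arrows of \<open>H\<close> form a compact set, and each of them has an end
  different from \<open>v\<close>. A small enough neighbourhood of \<open>v\<close> avoids that end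
  for all nearby arrows too, and finitely many such neighbourhoods are intersected.\<close>

lemma transversal_nhd:
  assumes v: "v \<in> Units"
  obtains N where "compactin T N" "openin T N" "v \<in> N" "transversal N"
proof -
  define R where "R A N \<longleftrightarrow> compactin T N \<and> openin T N \<and> v \<in> N \<and> (\<forall>h\<in>A. \<r> h \<notin> N \<or> \<s> h \<notin> N)" for A N
  have cpt: "compactin T (H - Units)"
    using compactin_Diff_openin compact_H openin_units by blast
  have "\<exists>A. openin T A \<and> h \<in> A \<and> (\<exists>N. R A N)" if h: "h \<in> H - Units" for h
  proof -
    have hC: "h \<in> Car"
      using h by auto
    \<comment> \<open>Principality: an arrow of \<open>H\<close> with equal ends coincides with the
      unit at its source.\<close>
    have "\<r> h \<noteq> \<s> h"
      using H_eqI[of h "\<s> h"] h hC units_H[of "\<s> h"] by (metis DiffE carr(4,5) unitsI(1))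
    then consider "\<r> h \<noteq> v" | "\<s> h \<noteq> v" by metis
    then show ?thesis
    proof cases
      case 1
      then obtain N where N: "compactin T N" "openin T N" "v \<in> N" "\<r> h \<notin> N"
        using compact_open_separation[of v "\<r> h"] v hC by (metis carr(2))
      have "openin T {x \<in> Car. \<r> x \<in> Car - N}"
        using openin_r_preimage[OF openin_Diff_compactin[OF haus openin_topspace N(1)]] by simp
      then show ?thesis
        using N hC by (intro exI[of _ "{x \<in> Car. \<r> x \<in> Car - N}"]) (auto simp: R_def)
    next
      case 2
      then obtain N where N: "compactin T N" "openin T N" "v \<in> N" "\<s> h \<notin> N"
        using compact_open_separation[of v "\<s> h"] v hC by (metis carr(1))
      have "openin T {x \<in> Car. \<s> x \<in> Car - N}"
        using openin_s_preimage[OF openin_Diff_compactin[OF haus openin_topspace N(1)]] by simp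
      then show ?thesis
        using N hC by (intro exI[of _ "{x \<in> Car. \<s> x \<in> Car - N}"]) (auto simp: R_def)
    qed
  qed
  then obtain \<A> where \<A>: "finite \<A>" "\<And>A. A \<in> \<A> \<Longrightarrow> openin T A \<and> (\<exists>N. R A N)" "H - Units \<subseteq> \<Union>\<A>"
    using compactin_finite_cover[OF cpt, of "\<lambda>A. \<exists>N. R A N"] by blast
  then obtain N where "\<And>A. A \<in> \<A> \<Longrightarrow> R A (N A)"
    by metis
  then have N: "\<And>A. A \<in> \<A> \<Longrightarrow> compactin T (N A) \<and> openin T (N A) \<and> v \<in> N A \<and>
      (\<forall>h\<in>A. \<r> h \<notin> N A \<or> \<s> h \<notin> N A)"
    unfolding R_def by blast
  \<comment> \<open>Including \<open>Units\<close> keeps the intersection inside a compact set even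
    when \<open>\<A>\<close> is empty, as may happen for \<open>H = Units\<close>.\<close>
  define M where "M = \<Inter> (insert Units (N ` \<A>))"
  have "openin T M"
    unfolding M_def using \<A>(1) N openin_units by (intro openin_Inter) auto
  moreover have "compactin T M"
    unfolding M_def using N compact_units compactin_imp_closedin[OF haus]
    by (intro closed_compactin_Inter[OF compact_units]) auto
  moreover have "transversal M"
    unfolding transversal_def
  proof (intro ballI impI)
    fix h assume h: "h \<in> H" "\<r> h \<in> M" "\<s> h \<in> M"
    have "h \<in> Units"
    proof (rule ccontr)
      assume "h \<notin> Units"
      then obtain A where "A \<in> \<A>" "h \<in> A"
        using \<A>(3) h(1) by blast
      then show False
        using N h(2,3) unfolding M_def by blast
    qed
    then show "\<r> h = \<s> h" by simp
  qed
  moreover have "v \<in> M"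
    using v N by (simp add: M_def)
  ultimately show thesis
    using that by blast
qed

end

section \<open>The castle of an elementary subgroupoid\<close>

locale transversal_partition = elementary_subgroupoid +
  fixes n :: nat and P :: "nat \<Rightarrow> 'a set"
  assumes P_open: "a < n \<Longrightarrow> openin T (P a)" and P_compact: "a < n \<Longrightarrow> compactin T (P a)"
    and P_transversal: "a < n \<Longrightarrow> transversal (P a)"
    and P_units: "(\<Union>a<n. P a) = Units" and P_disjoint: "disjoint_family P"
begin

text \<open>This set of indices depends only on the \<open>H\<close>-orbit of \<open>w\<close>. It
  serves as the label of the tower to which the orbit belongs, while the levels keep the indices of
  the partition.\<close>

definition visits :: "'a \<Rightarrow> nat set" where
  "visits w = {a. a < n \<and> (\<exists>h\<in>H. \<s> h = w \<and> \<r> h \<in> P a)}"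

definition level :: "nat set \<Rightarrow> nat \<Rightarrow> 'a set" where
  "level S a = {w \<in> Units. w \<in> P a \<and> visits w = S}"

definition piece :: "nat set \<Rightarrow> nat \<Rightarrow> nat \<Rightarrow> 'a set" where
  "piece S a b = {h \<in> H. \<r> h \<in> level S a \<and> \<s> h \<in> level S b}"

section \<open>Orbits and the pieces they visit\<close>

lemma P_unique: "w \<in> P a \<Longrightarrow> w \<in> P b \<Longrightarrow> a = b"
  using P_disjoint unfolding disjoint_family_on_def by blast

text \<open>An arrow that leads from the range of \<open>h\<close> into \<open>P a\<close> can be
  composed with \<open>h\<close>. Equality follows in \<open>visits_invariant\<close> by applying
  this to the inverse of \<open>h\<close>.\<close>

lemma visits_mono: "h \<in> H \<Longrightarrow> visits (\<r> h) \<subseteq> visits (\<s> h)"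
proof
  fix a assume h: "h \<in> H" and "a \<in> visits (\<r> h)"
  then obtain g where "a < n" "g \<in> H" "\<s> g = \<r> h" "\<r> g \<in> P a"
    unfolding visits_def by blast
  then show "a \<in> visits (\<s> h)"
    using h H_mult[of g h] unfolding visits_def by (auto intro!: bexI[of _ "\<m> g h"])
qed

lemma visits_invariant: "h \<in> H \<Longrightarrow> visits (\<r> h) = visits (\<s> h)"
  using visits_mono[of h] visits_mono[of "\<iota> h"] H_inv by auto

lemma visits_own: "w \<in> Units \<Longrightarrow> a < n \<Longrightarrow> w \<in> P a \<Longrightarrow> a \<in> visits w"
  unfolding visits_def using units_H[of w] by force

text \<open>The product of \<open>x\<close> with the inverse of \<open>y\<close> joins two points of
  the transversal set \<open>P a\<close>, so the ranges agree; principality then identifies the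
  arrows.\<close>

lemma fibre_unique:
  assumes "x \<in> H" "y \<in> H" "\<s> x = \<s> y" "a < n" "\<r> x \<in> P a" "\<r> y \<in> P a"
  shows "x = y"
proof -
  have "\<r> (\<m> x (\<iota> y)) = \<s> (\<m> x (\<iota> y))"
    using assms P_transversal[of a] H_mult[of x "\<iota> y"] H_inv[of y]
    by (intro P_transversal[unfolded transversal_def, rule_format, of a]) auto
  then show ?thesis
    using assms H_eqI by simp
qed

text \<open>Each visited piece is reached from \<open>u\<close> by exactly one arrow of
  \<open>H\<close>. This translates counts of levels in a tower into counts of arrows, to which the
  invariance estimate applies.\<close>

lemma card_visits:
  assumes "A \<subseteq> {..<n}"
  shows "card (visits u \<inter> A) = card {x \<in> sfibre G H u. \<r> x \<in> (\<Union>a\<in>A. P a)}"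
proof -
  obtain h where h: "\<And>a. a \<in> visits u \<Longrightarrow> h a \<in> H \<and> \<s> (h a) = u \<and> \<r> (h a) \<in> P a"
    unfolding visits_def by (atomize_elim, intro choice) blast
  have "bij_betw h (visits u \<inter> A) {x \<in> sfibre G H u. \<r> x \<in> (\<Union>a\<in>A. P a)}"
  proof (rule bij_betw_imageI)
    show "inj_on h (visits u \<inter> A)"
      using h P_unique by (metis (mono_tags, lifting) IntD1 inj_onI)
    show "h ` (visits u \<inter> A) = {x \<in> sfibre G H u. \<r> x \<in> (\<Union>a\<in>A. P a)}"
    proof safe
      fix x a assume x: "x \<in> sfibre G H u" and a: "a \<in> A" "\<r> x \<in> P a"
      then have v: "a \<in> visits u"
        using assms by (auto simp: visits_def sfibre_def)
      then have "x = h a"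
        using x a h[OF v] fibre_unique[of x "h a" a] assms by (auto simp: sfibre_def)
      then show "x \<in> h ` (visits u \<inter> A)"
        using v a by blast
    qed (use h in \<open>auto simp: sfibre_def\<close>)
  qed
  then show ?thesis
    by (rule bij_betw_same_card)
qed

text \<open>For every \<open>b\<close> the units whose orbit visits \<open>P b\<close> form a clopen
  set \<open>W b\<close>, being the source image of a compact open part of \<open>H\<close>.
  Prescribing the whole set \<open>S\<close> is then a finite intersection of such sets and
  complements.\<close>

lemma openin_level:
  assumes "a < n" "S \<subseteq> {..<n}"
  shows "openin T (level S a)"
proof -
  define W where "W b = \<s> ` {h \<in> H. \<r> h \<in> P b}" for b
  have W: "openin T (W b)" "compactin T (W b)" if b: "b < n" for b
  proof -
    have "{h \<in> H. \<r> h \<in> P b} = H \<inter> {x \<in> Car. \<r> x \<in> P b}"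
      by auto
    then show "openin T (W b)"
      unfolding W_def using open_H openin_r_preimage[OF P_open[OF b]]
      by (simp add: openin_s_image openin_Int)
    \<comment> \<open>Removing an open set from the compact set \<open>H\<close> exhibits the same
      arrows as a compact set.\<close>
    have eq: "{h \<in> H. \<r> h \<in> P b} = H - {x \<in> Car. \<r> x \<in> Units - P b}"
      using P_units b by auto
    show "compactin T (W b)"
      unfolding W_def eq
      by (intro compactin_s_image compactin_Diff_openin compact_H openin_r_preimage
          openin_Diff_compactin haus openin_units P_compact b)
  qed
  have "visits w = {b. b < n \<and> w \<in> W b}" for w
    by (auto simp: visits_def W_def)
  then have vis: "visits w = S \<longleftrightarrow> (\<forall>b<n. b \<in> S \<longleftrightarrow> w \<in> W b)" for w
    using assms(2) by blast
  define Z where "Z b = (if b \<in> S then W b else Units - W b)" for b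
  have Z: "w \<in> Z b \<longleftrightarrow> (b \<in> S \<longleftrightarrow> w \<in> W b)" if "w \<in> Units" for w b
    using that by (simp add: Z_def)
  have "level S a = \<Inter> (insert (Units \<inter> P a) (Z ` {..<n}))"
  proof (rule set_eqI)
    show "w \<in> level S a \<longleftrightarrow> w \<in> \<Inter> (insert (Units \<inter> P a) (Z ` {..<n}))" for w
      by (cases "w \<in> Units") (auto simp: level_def vis Z)
  qed
  moreover have "openin T \<dots>"
  proof (rule openin_Inter)
    show "openin T U" if "U \<in> insert (Units \<inter> P a) (Z ` {..<n})" for U
      using that W openin_units P_open[OF assms(1)] openin_Diff_compactin[OF haus openin_units]
      by (auto simp: Z_def)
  qed auto
  ultimately show ?thesis
    by simp
qed

lemma openin_piece:
  assumes "a < n" "b < n" "S \<subseteq> {..<n}"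
  shows "openin T (piece S a b)"
proof -
  have "piece S a b = H \<inter> ({x \<in> Car. \<r> x \<in> level S a} \<inter> {x \<in> Car. \<s> x \<in> level S b})"
    by (auto simp: piece_def)
  then show ?thesis
    using assms by (simp add: open_H openin_Int openin_r_preimage openin_s_preimage openin_level)
qed

lemma bisection_piece:
  assumes "a < n" "b < n"
  shows "bisection G (piece S a b)"
proof -
  have "x = y" if "x \<in> piece S a b" "y \<in> piece S a b" "\<r> x = \<r> y" for x y
  proof -
    have "\<iota> x = \<iota> y"
      using that assms(2) by (auto simp: piece_def level_def intro: H_inv fibre_unique[of "\<iota> x" "\<iota> y" b])
    then show ?thesis
      using that inv_inv unfolding piece_def by (metis (lifting) H_Car mem_Collect_eq)
  qed
  moreover have "x = y" if "x \<in> piece S a b" "y \<in> piece S a b" "\<s> x = \<s> y" for x y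
    using that assms(1) by (auto simp: piece_def level_def intro: fibre_unique[of x y a])
  ultimately show ?thesis
    unfolding bisection_def inj_on_def by (auto simp: piece_def)
qed

text \<open>Every orbit in tower \<open>S\<close> really visits \<open>P b\<close> when
  \<open>b \<in> S\<close>, so an arrow from level \<open>c\<close> to level \<open>a\<close> can be
  factored through level \<open>b\<close>.\<close>

lemma setprod_piece:
  assumes "b \<in> S"
  shows "setprod G (piece S a b) (piece S b c) = piece S a c"
proof
  show "setprod G (piece S a b) (piece S b c) \<subseteq> piece S a c"
    using H_mult by (auto simp: setprod_def piece_def)
  show "piece S a c \<subseteq> setprod G (piece S a b) (piece S b c)"
  proof
    fix h assume h: "h \<in> piece S a c"
    then obtain g where g: "g \<in> H" "\<s> g = \<s> h" "\<r> g \<in> P b"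
      using assms unfolding piece_def level_def visits_def by blast
    have hH: "h \<in> H" "\<r> h \<in> level S a" "\<s> h \<in> level S c"
      using h by (auto simp: piece_def)
    have lev: "\<r> g \<in> level S b"
      using g hH visits_invariant[OF g(1)] by (simp add: level_def)
    have "\<m> (\<m> h (\<iota> g)) g = h"
      using mult_inv_cancel(1)[of h "\<iota> g"] hH g by simp
    moreover have "\<m> h (\<iota> g) \<in> piece S a b" "g \<in> piece S b c"
      using hH g lev H_mult[of h "\<iota> g"] H_inv[of g] by (auto simp: piece_def)
    ultimately show "h \<in> setprod G (piece S a b) (piece S b c)"
      unfolding setprod_def using hH g
      by (intro CollectI exI[of _ "\<m> h (\<iota> g)"] exI[of _ g]) auto
  qed
qed

lemma piece_diagonal:
  assumes "a < n"
  shows "piece S a a = level S a"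
proof
  show "piece S a a \<subseteq> level S a"
  proof
    fix h assume h: "h \<in> piece S a a"
    then have "h = \<s> h"
      using assms fibre_unique[of h "\<s> h" a] units_H[of "\<s> h"] by (auto simp: piece_def level_def)
    then show "h \<in> level S a"
      using h by (auto simp: piece_def)
  qed
qed (use units_H in \<open>auto simp: piece_def level_def\<close>)

text \<open>Letting \<open>F l\<close> be any subset of \<open>S l\<close> covers both castles at
  once. Arrows of different towers are never composable, because the value of \<open>visits\<close>
  at a common unit would have to be both labels.\<close>

lemma open_castle_pieces:
  assumes I: "finite I" "inj_on S I" and S: "\<And>l. l \<in> I \<Longrightarrow> S l \<subseteq> {..<n}"
    and F: "\<And>l. l \<in> I \<Longrightarrow> F l \<subseteq> S l"
  shows "open_castle G I F (\<lambda>l. piece (S l))"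
proof -
  have Fn: "i < n" if "l \<in> I" "i \<in> F l" for l i
    using S F that by blast
  have "multisection G (F l) (piece (S l))" if l: "l \<in> I" for l
    unfolding multisection_def
  proof (intro conjI ballI impI)
    show "finite (F l)"
      using S[OF l] F[OF l] by (meson finite_lessThan finite_subset)
  next
    fix i j assume "i \<in> F l" "j \<in> F l" "i \<noteq> j"
    then show "piece (S l) i i \<inter> piece (S l) j j = {}"
      using P_unique by (fastforce simp: piece_def level_def)
  next
    fix i assume "i \<in> F l"
    then show "piece (S l) i i \<subseteq> Units"
      using piece_diagonal Fn l by (auto simp: level_def)
  qed (use F l Fn in \<open>auto intro!: bisection_piece setprod_piece\<close>)
  moreover have "setprod G (piece (S l) i j) (piece (S l') i' j') = {}"
    if "l \<in> I" "l' \<in> I" "l \<noteq> l'" for l l' i j i' j'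
    using that I(2) by (auto simp: setprod_def piece_def level_def inj_on_def)
  ultimately show ?thesis
    using I(1) openin_piece[OF Fn Fn S] unfolding open_castle_def castle_def by blast
qed

section \<open>The two nested castles and the comparison of levels\<close>

lemma level_cover:
  assumes "w \<in> Units"
  obtains a where "a < n" "a \<in> visits w" "w \<in> level (visits w) a"
proof -
  obtain a where "a < n" "w \<in> P a"
    using P_units assms by blast
  then show thesis
    using that visits_own assms by (auto simp: level_def)
qed

lemma H_subset_pieces:
  assumes "h \<in> H"
  obtains a b where "a \<in> visits (\<s> h)" "b \<in> visits (\<s> h)" "h \<in> piece (visits (\<s> h)) a b"
proof -
  obtain a where "a \<in> visits (\<r> h)" "\<r> h \<in> level (visits (\<r> h)) a"
    using level_cover assms by (metis H_Car unitsI(2))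
  moreover obtain b where "b \<in> visits (\<s> h)" "\<s> h \<in> level (visits (\<s> h)) b"
    using level_cover assms by (metis H_Car unitsI(1))
  ultimately show thesis
    using that visits_invariant[OF assms] assms by (simp add: piece_def)
qed

text \<open>Both castles consist of the same bisections \<open>C l i j\<close>; the smaller one
  merely omits the levels that meet \<open>R\<close>. The omitted levels are compared with
  \<open>Ob\<close> inside each tower separately.\<close>

lemma castle_witness:
  assumes R: "R \<subseteq> Units" "\<And>a. a < n \<Longrightarrow> P a \<subseteq> R \<or> P a \<inter> R = {}"
    and Ob: "Ob \<subseteq> Units" "\<And>a. a < n \<Longrightarrow> P a \<subseteq> Ob \<or> P a \<inter> Ob = {}"
    and K: "\<And>k. k \<in> K \<Longrightarrow> \<s> k \<notin> R \<Longrightarrow> k \<in> H"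
    and count: "\<And>u. u \<in> Units \<Longrightarrow>
      card {x \<in> sfibre G H u. \<r> x \<in> R} \<le> card {x \<in> sfibre G H u. \<r> x \<in> Ob}"
    and V: "\<And>a. a < n \<Longrightarrow> \<exists>V\<in>\<V>. P a \<subseteq> V"
  shows "\<exists>I F C E D. open_castle G I F C \<and> open_castle G I E D \<and> extendable G K I F C E D \<and>
    (\<forall>L\<in>castle_levels I E D. \<exists>V\<in>\<V>. L \<subseteq> V) \<and> subequiv G (Units - \<Union>(castle_levels I F C)) Ob"
proof -
  have fin: "finite (visits ` Units)"
    by (rule finite_subset[of _ "Pow {..<n}"]) (auto simp: visits_def)
  \<comment> \<open>Only values of \<open>visits\<close> that occur become towers, so each tower has
    a unit at which \<open>count\<close> can be applied.\<close>
  define I where "I = {0..<card (visits ` Units)}"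
  obtain S where S: "bij_betw S I (visits ` Units)"
    using ex_bij_betw_nat_finite[OF fin] unfolding I_def by blast
  have finI: "finite I" and injS: "inj_on S I" and imS: "S ` I = visits ` Units"
    using S by (auto simp: I_def bij_betw_def)
  have S_visits: "S l \<in> visits ` Units" if "l \<in> I" for l
    unfolding imS[symmetric] using that by (rule imageI)
  have Sn: "S l \<subseteq> {..<n}" if "l \<in> I" for l
    using S_visits[OF that] by (auto simp: visits_def)
  have Sl: "\<exists>l\<in>I. S l = visits w" if "w \<in> Units" for w
  proof -
    have "visits w \<in> S ` I"
      unfolding imS using that by (rule imageI)
    then show ?thesis
      by auto
  qed
  define F where "F l = {i \<in> S l. P i \<inter> R = {}}" for l
  define C where "C l = piece (S l)" for l
  have ocF: "open_castle G I F C" and ocS: "open_castle G I S C"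
    unfolding C_def using finI injS Sn by (auto intro!: open_castle_pieces simp: F_def)
  have HD: "H \<subseteq> castle_union I S C"
  proof
    fix h assume h: "h \<in> H"
    then show "h \<in> castle_union I S C"
      using H_subset_pieces[OF h] Sl[of "\<s> h"] unfolding castle_union_def C_def
      by (metis (no_types, lifting) H_Car UN_I unitsI(1))
  qed
  have "setprod G K (castle_union I F C) \<subseteq> H"
  proof
    fix y assume "y \<in> setprod G K (castle_union I F C)"
    then obtain k x l i j where k: "k \<in> K" "y = \<m> k x" "\<s> k = \<r> x"
      and x: "l \<in> I" "i \<in> F l" "x \<in> C l i j"
      unfolding setprod_def castle_union_def by blast
    \<comment> \<open>Arrows of the smaller castle end outside \<open>R\<close>, so any
      \<open>k\<close> composable with one of them is in \<open>H\<close>, and so is the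
      product.\<close>
    have xH: "x \<in> H" "\<r> x \<notin> R"
      using x by (auto simp: F_def C_def piece_def level_def)
    then show "y \<in> H"
      using K[OF k(1)] k H_mult by simp
  qed
  then have ext: "extendable G K I F C S C"
    using HD unfolding extendable_def by (auto simp: F_def)
  have lev: "\<forall>L\<in>castle_levels I S C. \<exists>V\<in>\<V>. L \<subseteq> V"
  proof
    fix L assume "L \<in> castle_levels I S C"
    then obtain l i where li: "l \<in> I" "i \<in> S l" "L = C l i i"
      unfolding castle_levels_def by blast
    then have i: "i < n"
      using Sn by blast
    then have "L \<subseteq> P i"
      using li piece_diagonal by (auto simp: C_def level_def)
    then show "\<exists>V\<in>\<V>. L \<subseteq> V"
      using V[OF i] by (meson order_trans)
  qed
  define bad where "bad = {a. a < n \<and> P a \<inter> R \<noteq> {}}"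
  define good where "good = {a. a < n \<and> P a \<inter> Ob \<noteq> {}}"
  \<comment> \<open>Each piece lies inside \<open>R\<close> or misses it, and likewise for
    \<open>Ob\<close>, so the two sets are exact unions of pieces.\<close>
  have unions: "(\<Union>a\<in>bad. P a) = R" "(\<Union>a\<in>good. P a) = Ob"
  proof -
    have "(\<Union>a\<in>{a. a < n \<and> P a \<inter> A \<noteq> {}}. P a) = A"
      if A: "A \<subseteq> Units" "\<And>a. a < n \<Longrightarrow> P a \<subseteq> A \<or> P a \<inter> A = {}" for A
    proof
      show "(\<Union>a\<in>{a. a < n \<and> P a \<inter> A \<noteq> {}}. P a) \<subseteq> A"
        using A(2) by (intro UN_least) auto
      show "A \<subseteq> (\<Union>a\<in>{a. a < n \<and> P a \<inter> A \<noteq> {}}. P a)"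
      proof
        fix x assume x: "x \<in> A"
        then have "x \<in> (\<Union>a<n. P a)"
          unfolding P_units using A(1) by blast
        then obtain a where "a < n" "x \<in> P a"
          by blast
        then show "x \<in> (\<Union>a\<in>{a. a < n \<and> P a \<inter> A \<noteq> {}}. P a)"
          using x by blast
      qed
    qed
    then show "(\<Union>a\<in>bad. P a) = R" "(\<Union>a\<in>good. P a) = Ob"
      unfolding bad_def good_def using R Ob by auto
  qed
  \<comment> \<open>By \<open>card_visits\<close>, the assumption \<open>count\<close> at a unit of
    the tower says that there are at most as many bad levels as good ones.\<close>
  have "\<exists>\<sigma>. \<sigma> ` (S l \<inter> bad) \<subseteq> S l \<inter> good \<and> inj_on \<sigma> (S l \<inter> bad)" if l: "l \<in> I" for l
  proof -
    obtain u where u: "u \<in> Units" "S l = visits u"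
      using S_visits[OF l] by auto
    have sub: "bad \<subseteq> {..<n}" "good \<subseteq> {..<n}"
      by (auto simp: bad_def good_def)
    then have "card (S l \<inter> bad) \<le> card (S l \<inter> good)"
      unfolding u(2) card_visits[OF sub(1)] card_visits[OF sub(2)] unions by (intro count u(1))
    then show ?thesis
      using card_le_inj[of "S l \<inter> bad" "S l \<inter> good"] sub
      by (metis finite_Int finite_lessThan finite_subset)
  qed
  then obtain \<sigma> where \<sigma>: "\<And>l. l \<in> I \<Longrightarrow> \<sigma> l ` (S l \<inter> bad) \<subseteq> S l \<inter> good \<and> inj_on (\<sigma> l) (S l \<inter> bad)"
    by metis
  define J where "J = (SIGMA l:I. S l \<inter> bad)"
  \<comment> \<open>The bisection for a bad level \<open>i\<close> of tower \<open>l\<close> carries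
    it to the good level \<open>\<sigma> l i\<close> of the same tower.\<close>
  define B where "B = (\<lambda>(l, i). C l (\<sigma> l i) i)"
  have J: "l \<in> I" "i \<in> S l" "i < n" "i \<in> bad" "\<sigma> l i \<in> S l" "\<sigma> l i \<in> good" "\<sigma> l i < n"
    if "(l, i) \<in> J" for l i
    using that \<sigma>[of l] by (auto simp: J_def bad_def good_def)
  have sub: "subequiv G (Units - \<Union>(castle_levels I F C)) Ob"
  proof (rule subequiv_finite_family[of J _ B])
    show "finite J"
      unfolding J_def using finI by (auto simp: bad_def)
  next
    fix j assume "j \<in> J"
    then obtain l i where li: "j = (l, i)" "(l, i) \<in> J"
      by (cases j) auto
    note J' = J[OF li(2)]
    show "open_bisection G (B j)"
      unfolding open_bisection_def B_def C_def li(1) prod.case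
      using J' Sn[OF J'(1)] by (simp add: openin_piece bisection_piece)
    have "P (\<sigma> l i) \<subseteq> Ob"
      using unions(2) J'(6) by blast
    then show "\<r> ` B j \<subseteq> Ob"
      by (auto simp: B_def C_def li piece_def level_def)
  next
    fix j j' assume "j \<in> J" "j' \<in> J" "j \<noteq> j'"
    then obtain l i l' i' where li: "j = (l, i)" "(l, i) \<in> J" "j' = (l', i')" "(l', i') \<in> J"
      by (cases j; cases j') auto
    show "\<r> ` B j \<inter> \<r> ` B j' = {}"
    proof (rule ccontr)
      assume "\<r> ` B j \<inter> \<r> ` B j' \<noteq> {}"
      \<comment> \<open>A common range point determines its tower and its level there; injectivity
        of \<open>S\<close> and of \<open>\<sigma> l\<close> then forces the two indices to
        agree.\<close>
      then obtain w where w: "w \<in> level (S l) (\<sigma> l i)" "w \<in> level (S l') (\<sigma> l' i')"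
        by (auto simp: B_def C_def li piece_def)
      then have "S l = S l'"
        by (auto simp: level_def)
      then have l: "l = l'"
        using injS J(1)[OF li(2)] J(1)[OF li(4)] by (simp add: inj_on_def)
      have "\<sigma> l i = \<sigma> l' i'"
        using w P_unique by (auto simp: level_def)
      then have "i = i'"
        using l \<sigma>[OF J(1)[OF li(2)]] J[OF li(2)] J[OF li(4)] by (simp add: inj_on_def)
      then show False
        using \<open>j \<noteq> j'\<close> li l by simp
    qed
  next
    show "Units - \<Union>(castle_levels I F C) \<subseteq> (\<Union>j\<in>J. \<s> ` B j)"
    proof
      fix w assume w: "w \<in> Units - \<Union>(castle_levels I F C)"
      then obtain a where a: "a < n" "a \<in> visits w" "w \<in> level (visits w) a"
        using level_cover by blast
      obtain l where l: "l \<in> I" "S l = visits w"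
        using Sl w by blast
      \<comment> \<open>The unit \<open>w\<close> lies in level \<open>a\<close> of tower
        \<open>l\<close>, so the level must be one of those omitted from the smaller castle.\<close>
      have "a \<notin> F l"
      proof
        assume "a \<in> F l"
        then have "C l a a \<in> castle_levels I F C"
          using l(1) unfolding castle_levels_def by blast
        moreover have "w \<in> C l a a"
          using a l piece_diagonal by (simp add: C_def)
        ultimately show False
          using w by blast
      qed
      then have j: "(l, a) \<in> J"
        using a l by (auto simp: J_def F_def bad_def)
      then obtain h where h: "h \<in> H" "\<s> h = w" "\<r> h \<in> P (\<sigma> l a)"
        using J(5)[OF j] unfolding l(2) visits_def by blast
      then have "h \<in> B (l, a)"
        using a(3) l(2) visits_invariant[OF h(1)] by (auto simp: B_def C_def piece_def level_def)
      then show "w \<in> (\<Union>j\<in>J. \<s> ` B j)"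
        using j h(2) by blast
    qed
  qed
  show ?thesis
    using ocF ocS ext lev sub by blast
qed

end

section \<open>Almost finite minimal groupoids\<close>

lemma subequiv_mono:
  assumes "subequiv G A V" "V \<subseteq> W"
  shows "subequiv G A W"
  using assms(1) order_trans[OF _ assms(2)] unfolding subequiv_def by (elim ex_forward conj_forward) blast+

context elementary_subgroupoid
begin

text \<open>Let \<open>a\<close> be the size of the fibre, \<open>e\<close> the number of products
  leaving it, and \<open>ob\<close> the number of its arrows ending in \<open>Ob\<close>. The moved
  arrows number at most \<open>card \<K> * e\<close>, while
  \<open>a \<le> card \<B> * (ob + e)\<close>. With the invariance bound on \<open>e\<close> this
  yields \<open>card \<K> * e < ob\<close>.\<close>

lemma card_moved_le_card_target:
  assumes fin: "finite \<K>" "finite \<B>"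
    and bis: "\<And>B. B \<in> \<K> \<union> \<B> \<Longrightarrow> bisection G B"
    and cover: "Units \<subseteq> (\<Union>B\<in>\<B>. \<s> ` B)" and range: "\<And>B. B \<in> \<B> \<Longrightarrow> \<r> ` B \<subseteq> Ob"
    and u: "u \<in> Units"
    and folner: "real (card (setprod G (\<Union>(\<K> \<union> \<B>)) (sfibre G H u) - sfibre G H u))
      < 1 / (real (card \<B>) * (real (card \<K>) + 1)) * real (card (sfibre G H u))"
  shows "card {x \<in> sfibre G H u. \<r> x \<in> \<s> ` (\<Union>\<K> - H)} \<le> card {x \<in> sfibre G H u. \<r> x \<in> Ob}"
proof -
  define Y where "Y = setprod G (\<Union>(\<K> \<union> \<B>)) (sfibre G H u)"
  define e where "e = card (Y - sfibre G H u)"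
  define ob where "ob = card {x \<in> sfibre G H u. \<r> x \<in> Ob}"
  define a where "a = card (sfibre G H u)"
  have carB: "k \<in> Car" if "k \<in> \<Union>(\<K> \<union> \<B>)" for k
    using bis that unfolding bisection_def by blast
  have finY: "finite Y"
    unfolding Y_def by (rule finite_setprod_bisections) (use fin bis finite_fibre in auto)
  have moved: "card {x \<in> sfibre G H u. \<r> x \<in> \<s> ` (\<Union>\<K> - H)} \<le> card \<K> * e"
    unfolding e_def
  proof (rule card_le_bisection_translates)
    fix x assume "x \<in> {x \<in> sfibre G H u. \<r> x \<in> \<s> ` (\<Union>\<K> - H)}"
    then obtain k B where x: "x \<in> H" "x \<in> sfibre G H u" and k: "B \<in> \<K>" "k \<in> B" "k \<notin> H" "\<s> k = \<r> x"
      unfolding sfibre_def by auto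
    \<comment> \<open>Otherwise multiplying by the inverse of \<open>x\<close> would put
      \<open>k\<close> into \<open>H\<close>.\<close>
    have "\<m> k x \<notin> H"
    proof
      assume kx: "\<m> k x \<in> H"
      have kC: "k \<in> Car"
        using carB k by blast
      then have "\<m> (\<m> k x) (\<iota> x) \<in> H"
        using H_mult[OF kx H_inv[OF x(1)]] x k by simp
      then show False
        using k x kC mult_inv_cancel(1)[of k x] by simp
    qed
    then have "\<m> k x \<in> Y - sfibre G H u"
      using x k unfolding Y_def setprod_def sfibre_def by blast
    then show "\<exists>B\<in>\<K>. \<exists>k\<in>B. \<s> k = \<r> x \<and> \<m> k x \<in> Y - sfibre G H u"
      using k by blast
  qed (use fin bis finY in \<open>auto simp: sfibre_def\<close>)
  have "a \<le> card \<B> * card {y \<in> Y. \<r> y \<in> Ob}"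
    unfolding a_def
  proof (rule card_le_bisection_translates)
    fix x assume x: "x \<in> sfibre G H u"
    then have xH: "x \<in> H"
      by (auto simp: sfibre_def)
    then obtain B k where k: "B \<in> \<B>" "k \<in> B" "\<s> k = \<r> x"
      using cover unitsI(2)[of x] by fastforce
    then have "\<m> k x \<in> Y"
      using x unfolding Y_def setprod_def by blast
    moreover have "k \<in> Car"
      using carB k by blast
    then have "\<r> (\<m> k x) \<in> Ob"
      using k range[of B] xH by auto
    ultimately show "\<exists>B\<in>\<B>. \<exists>k\<in>B. \<s> k = \<r> x \<and> \<m> k x \<in> {y \<in> Y. \<r> y \<in> Ob}"
      using k by blast
  qed (use fin bis finY in \<open>auto simp: sfibre_def\<close>)
  \<comment> \<open>A product ending in \<open>Ob\<close> either still belongs to the fibre or is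
    one of the \<open>e\<close> that left it.\<close>
  moreover have "card {y \<in> Y. \<r> y \<in> Ob} \<le> ob + e"
    unfolding ob_def e_def using finY finite_fibre
    by (intro order_trans[OF card_mono card_Un_le]) auto
  ultimately have "a \<le> card \<B> * (ob + e)"
    by (meson le_trans mult_le_mono2)
  then have a_le: "real a \<le> real (card \<B>) * (real ob + real e)"
    by (metis of_nat_add of_nat_le_iff of_nat_mult)
  have B_pos: "card \<B> > 0"
    using fin cover u by (auto simp: card_gt_0_iff)
  then have "real (card \<B>) * (real (card \<K>) + 1) > 0"
    by (simp add: add_nonneg_pos)
  moreover have "real e < real a / (real (card \<B>) * (real (card \<K>) + 1))"
    using folner by (simp add: e_def a_def Y_def)
  ultimately have "real e * (real (card \<B>) * (real (card \<K>) + 1)) < real a"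
    by (simp only: pos_less_divide_eq)
  with a_le have "real (card \<B>) * (real e * (real (card \<K>) + 1)) < real (card \<B>) * (real ob + real e)"
    by (simp add: algebra_simps)
  then have "real e * (real (card \<K>) + 1) < real ob + real e"
    using B_pos by simp
  then have "real (card \<K> * e) < real ob"
    by (simp add: algebra_simps)
  then show ?thesis
    using moved unfolding ob_def by linarith
qed

end

theorem theorem6p4:
  fixes G :: "'g groupoid"
  assumes "etale G"
    and "locally_compact_space (gtop G)"
    and "Hausdorff_space (gtop G)"
    and "sigma_compact_space (gtop G)"
    and "ample G"
    and "compactin (gtop G) (gunits G)"
    and "minimal G"
    and "almost_finite G"
  shows "almost_elementary G"
proof -
  interpret ample_groupoid G
    using assms by unfold_locales (auto simp: etale_def topological_groupoid_def)
  show ?thesis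
    unfolding almost_elementary_def
  proof (intro allI impI, elim conjE)
    fix K Ob \<V>
    assume K: "compactin T K" and Ob: "openin (subtopology T Units) Ob" "Ob \<noteq> {}"
      and \<V>: "\<forall>V\<in>\<V>. openin (subtopology T Units) V" "Units \<subseteq> \<Union>\<V>"
    have open_sub: "openin T U \<and> U \<subseteq> Units" if "openin (subtopology T Units) U" for U
      using that openin_units openin_trans_full[of T Units U] openin_subset[OF that] by auto
    obtain o' where "o' \<in> Ob"
      using Ob(2) by blast
    \<comment> \<open>Shrinking \<open>Ob\<close> to a compact open set \<open>O'\<close> makes it
      clopen, so that a partition can refine it.\<close>
    then obtain O' where O': "compactin T O'" "openin T O'" "o' \<in> O'" "O' \<subseteq> Ob"
      using open_sub[OF Ob(1)] compact_open_nhd by metis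
    have O'U: "O' \<subseteq> Units" "O' \<noteq> {}"
      using O' open_sub[OF Ob(1)] by auto
    obtain \<K> where \<K>: "finite \<K>" "\<And>B. B \<in> \<K> \<Longrightarrow> openin T B \<and> bisection G B \<and> compactin T B" "K \<subseteq> \<Union>\<K>"
      using compact_open_bisections_cover[OF K] by blast
    obtain \<B> where \<B>: "finite \<B>" "Units \<subseteq> (\<Union>B\<in>\<B>. \<s> ` B)"
      "\<And>B. B \<in> \<B> \<Longrightarrow> openin T B \<and> bisection G B \<and> compactin T B \<and> \<r> ` B \<subseteq> O'"
      using minimal_bisections_into[OF \<open>minimal G\<close> O'(2) O'U] by metis
    \<comment> \<open>The factor \<open>card \<B>\<close> comes from translating the fibre into
      \<open>O'\<close>, and the summand \<open>1\<close> absorbs the \<open>e\<close> in the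
      resulting bound \<open>card \<B> * (ob + e)\<close>.\<close>
    define \<epsilon> where "\<epsilon> = 1 / (real (card \<B>) * (real (card \<K>) + 1))"
    have "card \<B> > 0"
      using \<B> O'U by (auto simp: card_gt_0_iff)
    then have "\<epsilon> > 0"
      by (simp add: \<epsilon>_def add_nonneg_pos)
    moreover have "compactin T (\<Union>(\<K> \<union> \<B>))"
      using \<K> \<B> by (intro compactin_Union) auto
    ultimately obtain H where H: "subgroupoid G H" "\<s> ` H = Units" "compactin T H" "openin T H"
        "principal_on G H"
      and folner: "\<And>u. u \<in> Units \<Longrightarrow>
        real (card (setprod G (\<Union>(\<K> \<union> \<B>)) (sfibre G H u) - sfibre G H u)) < \<epsilon> * real (card (sfibre G H u))"
      using \<open>almost_finite G\<close> unfolding almost_finite_def by meson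
    interpret elementary_subgroupoid G H
      using H by unfold_locales
    \<comment> \<open>These units are the sources of arrows of \<open>\<Union>\<K>\<close> outside
      \<open>H\<close>. The set is clopen because \<open>\<Union>\<K>\<close> and \<open>H\<close>
      are both compact and open.\<close>
    define R where "R = \<s> ` (\<Union>\<K> - H)"
    have K_Car: "\<Union>\<K> \<subseteq> Car"
      using \<K>(2) unfolding bisection_def by blast
    then have RU: "R \<subseteq> Units"
      by (auto simp: R_def)
    have "compactin T (\<Union>\<K>)" "openin T (\<Union>\<K>)"
      using \<K> by (auto intro: compactin_Union)
    then have R: "openin T R" "compactin T R"
      unfolding R_def using open_H compact_H
      by (simp_all add: openin_s_image compactin_s_image compactin_Diff_openin openin_Diff_compactin[OF haus])
    \<comment> \<open>All requirements on a piece are collected here; each passes to subsets, as the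
      partition lemma demands.\<close>
    define Q where "Q N \<longleftrightarrow> N \<subseteq> Units \<and> (N \<subseteq> R \<or> N \<inter> R = {}) \<and> (N \<subseteq> O' \<or> N \<inter> O' = {}) \<and>
      (\<exists>V\<in>\<V>. N \<subseteq> V) \<and> transversal N" for N
    have Q_sub: "Q M" if "Q N" "M \<subseteq> N" for M N
      using that unfolding Q_def transversal_def by blast
    have loc: "\<exists>N. openin T N \<and> v \<in> N \<and> compactin T N \<and> Q N" if v: "v \<in> Units" for v
    proof -
      obtain V where V: "V \<in> \<V>" "v \<in> V"
        using \<V>(2) v by blast
      then have "openin T V"
        using open_sub \<V>(1) by blast
      obtain N\<^sub>0 where N\<^sub>0: "openin T N\<^sub>0" "v \<in> N\<^sub>0" "transversal N\<^sub>0"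
        using transversal_nhd[OF v] by metis
      \<comment> \<open>Since \<open>R\<close> and \<open>O'\<close> are clopen, the side on which
        \<open>v\<close> lies is open in either case.\<close>
      define W where "W = Units \<inter> V \<inter> N\<^sub>0 \<inter> (if v \<in> R then R else Units - R) \<inter>
        (if v \<in> O' then O' else Units - O')"
      have "openin T W" "v \<in> W"
        unfolding W_def using v V N\<^sub>0 \<open>openin T V\<close> R O' openin_units
        by (auto intro!: openin_Int openin_Diff_compactin[OF haus])
      then obtain N where N: "compactin T N" "openin T N" "v \<in> N" "N \<subseteq> W"
        using compact_open_nhd by metis
      have "Q W"
        using V(1) N\<^sub>0(3) unfolding Q_def W_def transversal_def by auto
      then show ?thesis
        using N Q_sub by blast
    qed
    obtain n :: nat and P where P: "\<And>a. a < n \<Longrightarrow> openin T (P a) \<and> compactin T (P a) \<and> Q (P a)"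
      "Units \<subseteq> (\<Union>a<n. P a)" "disjoint_family P"
    proof (rule finite_compact_open_partition[OF haus compact_units, of Q])
      show "\<exists>N. openin T N \<and> v \<in> N \<and> compactin T N \<and> Q N" if "v \<in> Units" for v
        using loc[OF that] .
      show "Q M" if "Q N" "M \<subseteq> N" for M N
        using Q_sub[OF that] .
    qed (rule that)
    have PQ: "P a \<subseteq> Units" "P a \<subseteq> R \<or> P a \<inter> R = {}" "P a \<subseteq> O' \<or> P a \<inter> O' = {}"
      "\<exists>V\<in>\<V>. P a \<subseteq> V" "transversal (P a)" if "a < n" for a
      using P(1)[OF that] unfolding Q_def by blast+
    have "(\<Union>a<n. P a) = Units"
      using P(2) PQ(1) by (intro equalityI UN_least) auto
    then interpret transversal_partition G H n P
      using P PQ(5) by unfold_locales auto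
    have count: "card {x \<in> sfibre G H u. \<r> x \<in> R} \<le> card {x \<in> sfibre G H u. \<r> x \<in> O'}" if u: "u \<in> Units" for u
      unfolding R_def
      by (rule card_moved_le_card_target[OF \<K>(1) \<B>(1) _ \<B>(2) _ u])
         (use \<K>(2) \<B>(3) folner[OF u] \<epsilon>_def in auto)
    have core: "k \<in> H" if "k \<in> K" "\<s> k \<notin> R" for k
      using that \<K>(3) unfolding R_def by blast
    have "\<exists>I F C E D. open_castle G I F C \<and> open_castle G I E D \<and> extendable G K I F C E D \<and>
        (\<forall>L\<in>castle_levels I E D. \<exists>V\<in>\<V>. L \<subseteq> V) \<and> subequiv G (Units - \<Union>(castle_levels I F C)) O'"
      by (rule castle_witness[of R]) (fact RU O'U(1) | erule PQ(2-4) | erule (1) core | erule count)+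
    then show "\<exists>I F C E D. open_castle G I F C \<and> open_castle G I E D \<and> extendable G K I F C E D \<and>
        (\<forall>L\<in>castle_levels I E D. \<exists>V\<in>\<V>. L \<subseteq> V) \<and> subequiv G (Units - \<Union>(castle_levels I F C)) Ob"
      by (elim ex_forward conj_forward) (assumption | erule subequiv_mono[OF _ O'(4)])+
  qed
qed

end
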